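(* Let $G$ be a connected simple graph with $n\ge 2$ vertices and $m$ edges, and let $q(G)$ be the largest signless Laplacian eigenvalue of $G$. Then $$QE(G)\le \frac{2m}{n(n-1)}+n-2+\sqrt{(n-1)\Big(mn+\frac{2m^2(2-n)}{n(n-1)}-\Big(q(G)-\frac{2m}{n}\Big)^2\Big)},$$ with equality if and only if $G\cong K_n$.
   Context: The signless Laplacian matrix of $G$ is $Q(G)=D(G)+A(G)$ ($A(G)$ adjacency matrix, $D(G)$ diagonal degree matrix), with eigenvalues $q_1\ge\dots\ge q_n\ge0$ and $q(G)=q_1$. The signless Laplacian energy is $QE(G)=\sum_{i=1}^n\big|q_i-\frac{2m}{n}\big|$. $K_n$ is the complete graph on $n$ vertices. *)

theory Defs
  imports
    "Graph_Theory.Digraph_Isomorphism"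
    "Graph_Theory.Kuratowski"
    "Jordan_Normal_Form.Char_Poly"
begin

text \<open>
  A finite simple graph is a \<open>graph\<close> in the sense of \<open>Graph_Theory\<close>: a finite symmetric digraph
  without loops and parallel arcs. Every undirected edge corresponds to two opposite arcs, so edges
  are counted as unordered pairs of end points, whereas the out-degree of a vertex is its degree.
\<close>

definition num_edges :: "('a, 'b) pre_digraph \<Rightarrow> nat" where
  "num_edges G = card {{u, v} | u v. u \<rightarrow>\<^bsub>G\<^esub> v}"

definition complete_graph :: "nat \<Rightarrow> (nat, nat \<times> nat) pre_digraph" where
  "complete_graph n =
     with_proj \<lparr>pverts = {..<n}, parcs = {(u, v). u < n \<and> v < n \<and> u \<noteq> v}\<rparr>"

lemma complete_digraph_complete_graph: "K\<^bsub>n\<^esub> (complete_graph n)"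
  unfolding complete_graph_def complete_digraph_pair_def by auto

text \<open>
  Matrices are indexed by positions in a list \<open>vs\<close> that enumerates the vertices without repetition.
  Another enumeration yields a permutation-similar matrix, hence the same spectrum.
\<close>

definition adjacency_mat :: "('a, 'b) pre_digraph \<Rightarrow> 'a list \<Rightarrow> real mat" where
  "adjacency_mat G vs =
     mat (length vs) (length vs) (\<lambda>(i, j). if vs ! i \<rightarrow>\<^bsub>G\<^esub> vs ! j then 1 else 0)"

definition degree_mat :: "('a, 'b) pre_digraph \<Rightarrow> 'a list \<Rightarrow> real mat" where
  "degree_mat G vs = mat_diag (length vs) (\<lambda>i. real (out_degree G (vs ! i)))"

definition signless_laplacian :: "('a, 'b) pre_digraph \<Rightarrow> 'a list \<Rightarrow> real mat" where
  "signless_laplacian G vs = degree_mat G vs + adjacency_mat G vs"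

text \<open>
  The multiset of eigenvalues \<open>q\<^sub>1, \<dots>, q\<^sub>n\<close>, counted with algebraic multiplicity. The matrix of a graph
  is real symmetric, so its characteristic polynomial splits over the reals and no
  eigenvalue is lost by taking real roots only.
\<close>

definition signless_spectrum :: "('a, 'b) pre_digraph \<Rightarrow> 'a list \<Rightarrow> real multiset" where
  "signless_spectrum G vs = proots (char_poly (signless_laplacian G vs))"

definition signless_radius :: "('a, 'b) pre_digraph \<Rightarrow> 'a list \<Rightarrow> real" where
  "signless_radius G vs = Max (set_mset (signless_spectrum G vs))"

definition signless_energy :: "('a, 'b) pre_digraph \<Rightarrow> 'a list \<Rightarrow> real" where
  "signless_energy G vs =
     (\<Sum>q \<in># signless_spectrum G vs. \<bar>q - 2 * real (num_edges G) / real (card (verts G))\<bar>)"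

end

theory Submission
  imports Defs "Jordan_Normal_Form.Schur_Decomposition"
begin

text \<open>
  Conjugating \<open>Q(G)\<close> by the degree matrix turns the row sum at \<open>u\<close> into \<open>d\<^sub>u + m\<^sub>u\<close>, where \<open>m\<^sub>u\<close> is the
  average degree of the neighbours of \<open>u\<close>. An exact formula for the slack shows that this row sum
  is at most \<open>b = 2m/(n-1) + n - 2\<close>, with equality only if \<open>u\<close> is adjacent to all other vertices or
  \<open>G\<close> is a star. Hence \<open>q(G) \<le> b\<close>, and averaging the row sums with weights \<open>d\<^sub>u\<close> gives de Caen's
  inequality \<open>\<Sum> d\<^sub>u\<^sup>2 \<le> m b\<close>, which bounds \<open>\<Sum> (q\<^sub>i - 2m/n)\<^sup>2\<close> through the trace of \<open>Q(G)\<^sup>2\<close>.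
  The theorem is then Cauchy-Schwarz for \<open>q\<^sub>2, \<dots>, q\<^sub>n\<close>. In the case of equality every row sum is
  \<open>b\<close>, so \<open>G\<close> is complete or a star; a star on at least three vertices has the eigenvalues 0 and 1,
  whose distances to \<open>2m/n \<ge> 1\<close> differ, against the equality case of Cauchy-Schwarz.
\<close>

section \<open>Spectra of real symmetric matrices\<close>

text \<open>For an eigenvector \<open>v\<close> the form \<open>s\<close>, which is v* A v, equals
  its own conjugate by symmetry. It also equals \<open>l\<close> times the positive squared norm
  \<open>N\<close> of \<open>v\<close>.\<close>

lemma symmetric_mat_complex_eigenvalue_real:
  fixes A :: "real mat" and l :: complex
  assumes A: "A \<in> carrier_mat n n"
    and sym: "\<And>i j. i < n \<Longrightarrow> j < n \<Longrightarrow> A $$ (i, j) = A $$ (j, i)"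
    and ev: "eigenvalue (map_mat of_real A) l"
  shows "l \<in> \<real>"
proof -
  obtain v where v: "v \<in> carrier_vec n" "v \<noteq> 0\<^sub>v n"
    and e: "map_mat of_real A *\<^sub>v v = l \<cdot>\<^sub>v v"
    using ev A unfolding eigenvalue_def eigenvector_def by auto
  have row: "(\<Sum>j<n. of_real (A $$ (i, j)) * v $ j) = l * v $ i" if i: "i < n" for i
  proof -
    have "(map_mat of_real A *\<^sub>v v) $ i = (\<Sum>j<n. of_real (A $$ (i, j)) * v $ j)"
      using A v(1) i by (auto simp: scalar_prod_def lessThan_atLeast0 intro!: sum.cong)
    then show ?thesis using e i v(1) by simp
  qed
  define s where "s = (\<Sum>i<n. \<Sum>j<n. cnj (v $ i) * of_real (A $$ (i, j)) * v $ j)"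
  define N where "N = (\<Sum>i<n. (cmod (v $ i))\<^sup>2)"
  have "cnj s = (\<Sum>i<n. \<Sum>j<n. cnj (v $ j) * of_real (A $$ (i, j)) * v $ i)"
    by (simp add: s_def mult_ac)
  also have "\<dots> = (\<Sum>j<n. \<Sum>i<n. cnj (v $ j) * of_real (A $$ (i, j)) * v $ i)"
    by (rule sum.swap)
  also have "\<dots> = s"
    unfolding s_def by (intro sum.cong refl) (simp add: sym)
  finally have "s \<in> \<real>" by (simp add: Reals_cnj_iff)
  have "s = (\<Sum>i<n. cnj (v $ i) * (l * v $ i))"
    unfolding s_def by (intro sum.cong refl) (simp add: row[symmetric] sum_distrib_left mult_ac)
  also have "\<dots> = l * of_real N"
    unfolding N_def of_real_sum sum_distrib_left
    by (intro sum.cong refl) (simp add: complex_norm_square[symmetric] mult_ac del: of_real_power)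
  finally have s: "s = l * of_real N" .
  obtain i where "i < n" "v $ i \<noteq> 0" using v by (auto simp: vec_eq_iff)
  then have "N > 0" unfolding N_def by (intro sum_pos2[of _ i]) auto
  then have "l = s / of_real N" using s by simp
  then show ?thesis using \<open>s \<in> \<real>\<close> by (simp add: Reals_divide)
qed

text \<open>Over the complex numbers the polynomial factors into linear terms. All its roots are
  real, so the factorization descends along the injective embedding of coefficients.\<close>

lemma symmetric_mat_char_poly_splits:
  fixes A :: "real mat"
  assumes A: "A \<in> carrier_mat n n"
    and sym: "\<And>i j. i < n \<Longrightarrow> j < n \<Longrightarrow> A $$ (i, j) = A $$ (j, i)"
  obtains es where "char_poly A = (\<Prod>e\<leftarrow>es. [:- e, 1:])" "length es = n"
proof -
  let ?C = "map_mat of_real A :: complex mat"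
  have C: "?C \<in> carrier_mat n n" using A by simp
  obtain as where as: "char_poly ?C = (\<Prod>a\<leftarrow>as. [:- a, 1:])" "length as = n"
    using char_poly_factorized[OF C] by blast
  have real: "a \<in> \<real>" if "a \<in> set as" for a
  proof -
    have "poly (char_poly ?C) a = 0"
      unfolding as(1) using that by (auto simp: poly_prod_list prod_list_zero_iff)
    then show ?thesis
      using symmetric_mat_complex_eigenvalue_real[OF A sym] eigenvalue_root_char_poly[OF C] by blast
  qed
  define es where "es = map Re as"
  have as_es: "as = map of_real es"
    unfolding es_def using real by (auto simp: o_def intro!: map_idI[symmetric])
  have cp: "char_poly ?C = map_poly of_real (char_poly A)"
    by (rule of_real_hom.char_poly_hom[OF A])
  interpret poly_hom: map_poly_comm_ring_hom "of_real :: real \<Rightarrow> complex" ..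
  have "map_poly of_real (\<Prod>e\<leftarrow>xs. [:- e, 1:]) = (\<Prod>a\<leftarrow>map of_real xs. [:- a, 1 :: complex:])"
    for xs :: "real list"
    by (induction xs) (simp_all add: poly_hom.hom_mult del: mult_pCons_left)
  then have "map_poly of_real (char_poly A) = map_poly (of_real :: real \<Rightarrow> complex) (\<Prod>e\<leftarrow>es. [:- e, 1:])"
    unfolding cp[symmetric] as(1) as_es by simp
  then have "char_poly A = (\<Prod>e\<leftarrow>es. [:- e, 1:])"
    by (simp add: poly_eq_iff coeff_map_poly)
  with as(2) show ?thesis by (intro that[of es]) (auto simp: es_def)
qed

section \<open>Traces, and the first two moments of the spectrum\<close>

lemma sum_diag_mult_commute:
  fixes X Y :: "'a :: comm_semiring_0 mat"
  assumes "X \<in> carrier_mat n n" "Y \<in> carrier_mat n n"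
  shows "(\<Sum>i<n. (X * Y) $$ (i, i)) = (\<Sum>i<n. (Y * X) $$ (i, i))"
proof -
  have "(\<Sum>i<n. (X * Y) $$ (i, i)) = (\<Sum>i<n. \<Sum>j<n. X $$ (i, j) * Y $$ (j, i))"
    using assms by (auto simp: scalar_prod_def lessThan_atLeast0 intro!: sum.cong)
  also have "\<dots> = (\<Sum>j<n. \<Sum>i<n. Y $$ (j, i) * X $$ (i, j))"
    by (subst sum.swap) (simp add: mult.commute)
  also have "\<dots> = (\<Sum>i<n. (Y * X) $$ (i, i))"
    using assms by (auto simp: scalar_prod_def lessThan_atLeast0 intro!: sum.cong)
  finally show ?thesis .
qed

lemma sum_diag_conjugate:
  fixes P Q X :: "'a :: comm_semiring_1 mat"
  assumes "P \<in> carrier_mat n n" "Q \<in> carrier_mat n n" "X \<in> carrier_mat n n" "Q * P = 1\<^sub>m n"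
  shows "(\<Sum>i<n. (P * X * Q) $$ (i, i)) = (\<Sum>i<n. X $$ (i, i))"
proof -
  have "(\<Sum>i<n. (P * X * Q) $$ (i, i)) = (\<Sum>i<n. (Q * (P * X)) $$ (i, i))"
    using assms by (intro sum_diag_mult_commute) auto
  also have "Q * (P * X) = X"
    using assms by (metis assoc_mult_mat left_mult_one_mat)
  finally show ?thesis .
qed

text \<open>In a Schur form A = P B Q the eigenvalues are the diagonal entries of the triangular
  \<open>B\<close>, and those of B^2 are their squares. Similarity preserves both traces, and
  symmetry makes the trace of A^2 the sum of the squared entries of \<open>A\<close>.\<close>

lemma
  fixes A :: "real mat"
  assumes A: "A \<in> carrier_mat n n"
    and sym: "\<And>i j. i < n \<Longrightarrow> j < n \<Longrightarrow> A $$ (i, j) = A $$ (j, i)"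
  shows size_proots_char_poly_symmetric: "size (proots (char_poly A)) = n"
    and sum_proots_char_poly_symmetric: "(\<Sum>x\<in>#proots (char_poly A). x) = (\<Sum>i<n. A $$ (i, i))"
    and sum_sq_proots_char_poly_symmetric:
      "(\<Sum>x\<in>#proots (char_poly A). x\<^sup>2) = (\<Sum>i<n. \<Sum>j<n. (A $$ (i, j))\<^sup>2)"
proof -
  obtain es where es: "char_poly A = (\<Prod>e\<leftarrow>es. [:- e, 1:])" "length es = n"
    using symmetric_mat_char_poly_splits[OF A sym] by blast
  have "proots (\<Prod>e\<leftarrow>xs. [:- e, 1:]) = mset xs" for xs :: "real list"
  proof (induction xs)
    case (Cons x xs)
    have "(\<Prod>e\<leftarrow>xs. [:- e, 1:]) \<noteq> 0" by (auto simp: prod_list_zero_iff)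
    then show ?case using Cons by (simp add: proots_mult del: mult_pCons_left)
  qed simp
  then have roots: "proots (char_poly A) = mset es" by (simp add: es)
  obtain B P Q where "schur_decomposition A es = (B, P, Q)"
    by (cases "schur_decomposition A es") auto
  from schur_decomposition[OF A es(1) this]
  have sim: "similar_mat_wit A B P Q" and tri: "upper_triangular B" and diag: "diag_mat B = es"
    by auto
  note w = similar_mat_witD2[OF A sim]
  \<comment> \<open>For j different from i, one of the entries (i, j) and (j, i) lies below the
    diagonal and vanishes.\<close>
  have BB: "(B * B) $$ (i, i) = (B $$ (i, i))\<^sup>2" if i: "i < n" for i
  proof -
    have "(B * B) $$ (i, i) = (\<Sum>j<n. B $$ (i, j) * B $$ (j, i))"
      using w i by (auto simp: scalar_prod_def lessThan_atLeast0 intro!: sum.cong)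
    also have "\<dots> = (\<Sum>j<n. if j = i then (B $$ (i, i))\<^sup>2 else 0)"
    proof (intro sum.cong refl)
      fix j assume "j \<in> {..<n}"
      then show "B $$ (i, j) * B $$ (j, i) = (if j = i then (B $$ (i, i))\<^sup>2 else 0)"
        using tri w i upper_triangularD[of B i j] upper_triangularD[of B j i]
        by (cases i j rule: linorder_cases) (auto simp: power2_eq_square)
    qed
    also have "\<dots> = (B $$ (i, i))\<^sup>2" using i by simp
    finally show ?thesis .
  qed
  have es_nth: "es = map (\<lambda>i. B $$ (i, i)) [0..<n]"
    using diag w by (auto simp: diag_mat_def)
  have es_sum: "(\<Sum>x\<in>#mset es. f x) = (\<Sum>i<n. f (B $$ (i, i)))" for f :: "real \<Rightarrow> real"
    unfolding es_nth by (simp add: sum_mset_sum_list o_def interv_sum_list_conv_sum_set_nat lessThan_atLeast0 flip: mset_map)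
  show "size (proots (char_poly A)) = n" using roots es by simp
  show "(\<Sum>x\<in>#proots (char_poly A). x) = (\<Sum>i<n. A $$ (i, i))"
    unfolding roots using es_sum[of "\<lambda>x. x"] sum_diag_conjugate[of P n Q B] w by simp
  \<comment> \<open>The inner factor Q P cancels, so the square is similar to B^2 through the same
    \<open>P\<close> and \<open>Q\<close>.\<close>
  have "A * A = P * B * (Q * (P * B * Q))" using w by (auto simp: assoc_mult_mat[of _ n n _ n _ n])
  also have "Q * (P * B * Q) = B * Q"
    using w by (metis assoc_mult_mat left_mult_one_mat mult_carrier_mat)
  finally have AA: "A * A = P * (B * B) * Q" using w by (auto simp: assoc_mult_mat[of _ n n _ n _ n])
  have "(\<Sum>i<n. \<Sum>j<n. (A $$ (i, j))\<^sup>2) = (\<Sum>i<n. (A * A) $$ (i, i))"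
    using A sym by (auto simp: scalar_prod_def lessThan_atLeast0 power2_eq_square intro!: sum.cong)
  also have "\<dots> = (\<Sum>i<n. (B * B) $$ (i, i))"
    unfolding AA using w by (intro sum_diag_conjugate) auto
  also have "\<dots> = (\<Sum>i<n. (B $$ (i, i))\<^sup>2)" using BB by simp
  finally show "(\<Sum>x\<in>#proots (char_poly A). x\<^sup>2) = (\<Sum>i<n. \<Sum>j<n. (A $$ (i, j))\<^sup>2)"
    unfolding roots using es_sum[of "\<lambda>x. x\<^sup>2"] by simp
qed

lemma set_proots_char_poly:
  fixes A :: "'a :: field mat"
  assumes "A \<in> carrier_mat n n"
  shows "x \<in># proots (char_poly A) \<longleftrightarrow> eigenvalue A x"
proof -
  have "char_poly A \<noteq> 0" using degree_monic_char_poly[OF assms] by auto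
  then show ?thesis using eigenvalue_root_char_poly[OF assms] by simp
qed

section \<open>Cauchy-Schwarz for multisets, with its equality case\<close>

lemma sum_mset_square_deviation:
  fixes f :: "'a \<Rightarrow> real"
  shows "(\<Sum>x\<in>#M. (f x - c)\<^sup>2) = (\<Sum>x\<in>#M. (f x)\<^sup>2) - 2 * c * (\<Sum>x\<in>#M. f x) + real (size M) * c\<^sup>2"
  by (induction M) (auto simp: power2_eq_square algebra_simps)

lemma sum_mset_square_nonneg: "(\<Sum>x\<in>#M. (f x :: real)\<^sup>2) \<ge> 0"
  by (induction M) auto

lemma sum_mset_square_eq_0: "(\<Sum>x\<in>#M. (f x :: real)\<^sup>2) = 0 \<Longrightarrow> x \<in># M \<Longrightarrow> f x = 0"
proof (induction M)
  case (add y M)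
  then show ?case using sum_mset_square_nonneg[of f M] by (auto simp: add_nonneg_eq_0_iff)
qed simp

text \<open>The gap between the two sides is the size of \<open>M\<close> times the sum of squared
  deviations from the mean. It is therefore nonnegative, and for nonempty \<open>M\<close> it
  vanishes only if \<open>f\<close> is constant on \<open>M\<close>.\<close>

lemma sum_mset_Cauchy_Schwarz:
  fixes f :: "'a \<Rightarrow> real"
  shows "(\<Sum>x\<in>#M. f x)\<^sup>2 \<le> real (size M) * (\<Sum>x\<in>#M. (f x)\<^sup>2)"
    and "(\<Sum>x\<in>#M. f x)\<^sup>2 = real (size M) * (\<Sum>x\<in>#M. (f x)\<^sup>2) \<Longrightarrow> x \<in># M \<Longrightarrow> y \<in># M \<Longrightarrow> f x = f y"
proof -
  \<comment> \<open>The mean of \<open>f\<close>. For empty \<open>M\<close> the division by zero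
    yields 0, and the identity below is trivial.\<close>
  define c where "c = (\<Sum>x\<in>#M. f x) / real (size M)"
  have *: "real (size M) * (\<Sum>x\<in>#M. (f x - c)\<^sup>2) = real (size M) * (\<Sum>x\<in>#M. (f x)\<^sup>2) - (\<Sum>x\<in>#M. f x)\<^sup>2"
  proof (cases "M = {#}")
    case False
    define S where "S = (\<Sum>x\<in>#M. f x)"
    define T where "T = (\<Sum>x\<in>#M. (f x)\<^sup>2)"
    have "S = real (size M) * c" using False unfolding c_def S_def[symmetric] by simp
    then show ?thesis
      unfolding sum_mset_square_deviation S_def[symmetric] T_def[symmetric]
      by (simp only: power2_eq_square) (simp add: algebra_simps)
  qed simp
  show "(\<Sum>x\<in>#M. f x)\<^sup>2 \<le> real (size M) * (\<Sum>x\<in>#M. (f x)\<^sup>2)"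
    using * sum_mset_square_nonneg[of "\<lambda>x. f x - c" M]
    by (smt (verit) mult_nonneg_nonneg of_nat_0_le_iff)
  assume "(\<Sum>x\<in>#M. f x)\<^sup>2 = real (size M) * (\<Sum>x\<in>#M. (f x)\<^sup>2)" "x \<in># M" "y \<in># M"
  then have "real (size M) * (\<Sum>x\<in>#M. (f x - c)\<^sup>2) = 0" "size M \<noteq> 0"
    using * by (simp only: diff_self, auto)
  then have "(\<Sum>x\<in>#M. (f x - c)\<^sup>2) = 0" by (metis mult_eq_0_iff of_nat_eq_0_iff)
  then show "f x = f y"
    using sum_mset_square_eq_0[of "\<lambda>x. f x - c" M] \<open>x \<in># M\<close> \<open>y \<in># M\<close> by fastforce
qed

section \<open>Degrees and weighted row sums\<close>

definition neighbours :: "('a, 'b) pre_digraph \<Rightarrow> 'a \<Rightarrow> 'a set" where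
  "neighbours G u = {v. u \<rightarrow>\<^bsub>G\<^esub> v}"

lemma in_neighbours [simp]: "v \<in> neighbours G u \<longleftrightarrow> u \<rightarrow>\<^bsub>G\<^esub> v"
  by (simp add: neighbours_def)

context graph
begin

lemma adj_commute: "u \<rightarrow>\<^bsub>G\<^esub> v \<longleftrightarrow> v \<rightarrow>\<^bsub>G\<^esub> u"
  using arcs_ends_symmetric[OF sym_arcs] by blast

lemma neighbours_subset: "neighbours G u \<subseteq> verts G - {u}"
  using adj_in_verts adj_not_same by (auto simp: neighbours_def)

lemma finite_neighbours [simp]: "finite (neighbours G u)"
  using finite_subset[OF neighbours_subset] by simp

text \<open>Without parallel arcs, an arc leaving \<open>u\<close> is determined by its
  head.\<close>

lemma out_degree_neighbours: "out_degree G u = card (neighbours G u)"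
proof -
  have "head G ` out_arcs G u = neighbours G u"
    by (force simp: out_arcs_def arcs_ends_conv)
  moreover have "inj_on (head G) (out_arcs G u)"
    by (rule inj_onI) (auto intro!: no_multi_arcs simp: arc_to_ends_def)
  ultimately show ?thesis
    unfolding out_degree_def by (metis card_image)
qed

lemma out_degree_le:
  assumes "u \<in> verts G"
  shows "out_degree G u \<le> card (verts G) - 1"
  using card_mono[OF _ neighbours_subset, of u] assms
  by (simp add: out_degree_neighbours)

lemma neighbours_eq_if_full:
  assumes "u \<in> verts G" "out_degree G u = card (verts G) - 1"
  shows "neighbours G u = verts G - {u}"
  using assms by (intro card_subset_eq neighbours_subset) (auto simp: out_degree_neighbours)

text \<open>Handshake lemma: every edge comes from exactly two opposite arcs, which are distinct
  because there are no loops.\<close>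

lemma sum_out_degree: "(\<Sum>u\<in>verts G. out_degree G u) = 2 * num_edges G"
proof -
  let ?f = "\<lambda>(u, v). {u, v} :: 'a set"
  have fin: "finite (arcs_ends G)" by (simp add: arcs_ends_def)
  have edges: "{{u, v} | u v. u \<rightarrow> v} = ?f ` arcs_ends G" by auto
  have "arcs_ends G = Sigma (verts G) (neighbours G)"
    using adj_in_verts by auto
  then have "(\<Sum>u\<in>verts G. out_degree G u) = card (arcs_ends G)"
    by (simp add: out_degree_neighbours)
  also have "\<dots> = (\<Sum>p\<in>arcs_ends G. 1)" by simp
  also have "\<dots> = (\<Sum>e\<in>?f ` arcs_ends G. \<Sum>p\<in>{p \<in> arcs_ends G. ?f p = e}. 1)"
    by (rule sum.image_gen[OF fin])
  also have "\<dots> = (\<Sum>e\<in>?f ` arcs_ends G. 2)"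
  proof (intro sum.cong refl)
    fix e assume "e \<in> ?f ` arcs_ends G"
    then obtain u v where uv: "u \<rightarrow> v" "e = {u, v}" by auto
    have vu: "v \<rightarrow> u" using uv(1) adj_commute[of u v] by simp
    have "{p \<in> arcs_ends G. ?f p = e} = {(u, v), (v, u)}"
    proof (intro equalityI subsetI)
      fix p assume "p \<in> {p \<in> arcs_ends G. ?f p = e}"
      then show "p \<in> {(u, v), (v, u)}" by (cases p) (simp add: uv(2) doubleton_eq_iff)
    next
      fix p assume "p \<in> {(u, v), (v, u)}"
      then show "p \<in> {p \<in> arcs_ends G. ?f p = e}"
        using uv vu by (elim insertE) (simp_all add: insert_commute)
    qed
    moreover have "u \<noteq> v" using uv(1) adj_not_same by blast
    ultimately show "(\<Sum>p\<in>{p \<in> arcs_ends G. ?f p = e}. 1) = (2 :: nat)" by simp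
  qed
  finally show ?thesis by (simp add: num_edges_def edges)
qed

text \<open>Double counting: by symmetry \<open>f v\<close> occurs once for each neighbour of
  \<open>v\<close>.\<close>

lemma sum_neighbours:
  fixes f :: "'a \<Rightarrow> real"
  shows "(\<Sum>u\<in>verts G. \<Sum>v\<in>neighbours G u. f v) = (\<Sum>v\<in>verts G. real (out_degree G v) * f v)"
proof -
  have N1: "neighbours G u = {v. v \<in> verts G \<and> u \<rightarrow> v}" for u
    using adj_in_verts by auto
  have N2: "{u. u \<in> verts G \<and> u \<rightarrow> v} = neighbours G v" for v
    using adj_in_verts adj_commute[of _ v] by auto
  have "(\<Sum>u\<in>verts G. \<Sum>v\<in>neighbours G u. f v) =
      (\<Sum>v\<in>verts G. \<Sum>u\<in>{u. u \<in> verts G \<and> u \<rightarrow> v}. f v)"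
    unfolding N1 by (rule sum.swap_restrict) simp_all
  also have "\<dots> = (\<Sum>v\<in>verts G. \<Sum>u\<in>neighbours G v. f v)"
    unfolding N2 ..
  finally have "(\<Sum>u\<in>verts G. \<Sum>v\<in>neighbours G u. f v) = (\<Sum>v\<in>verts G. \<Sum>u\<in>neighbours G v. f v)" .
  then show ?thesis by (simp add: out_degree_neighbours)
qed

text \<open>A walk from \<open>u\<close> to a different vertex has to leave \<open>u\<close> by some
  arc.\<close>

lemma connected_out_degree_pos:
  assumes "Digraph_Component.connected G" "card (verts G) \<ge> 2" "u \<in> verts G"
  shows "out_degree G u > 0"
proof -
  have "verts G \<noteq> {u}" using assms(2) by auto
  then obtain v where v: "v \<in> verts G" "v \<noteq> u" using assms(3) by auto
  have "u \<rightarrow>\<^sup>* v"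
    using symmetric_connected_imp_strongly_connected[OF sym_arcs assms(1)] v assms(3) by blast
  then obtain w where "u \<rightarrow> w"
    using v by (cases rule: converse_reachable_cases) auto
  then have "neighbours G u \<noteq> {}" by auto
  then show ?thesis by (simp add: out_degree_neighbours card_gt_0_iff)
qed

text \<open>The row sum at \<open>u\<close> of D^-1 Q D, where D is the degree matrix.\<close>

definition row_weight :: "'a \<Rightarrow> real" where
  "row_weight u = real (out_degree G u) +
     (\<Sum>v\<in>neighbours G u. real (out_degree G v)) / real (out_degree G u)"

definition weight_bound :: real where
  "weight_bound = 2 * real (num_edges G) / (real (card (verts G)) - 1) + real (card (verts G)) - 2"

text \<open>Split 2m into the degree of \<open>u\<close>, the degrees of its neighbours and those of
  the remaining n - 1 - d vertices, d being the degree of \<open>u\<close>. When all degrees lie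
  between 1 and n - 1, every term on the right is nonnegative, so the formula yields both the bound
  and its equality case.\<close>

lemma row_weight_slack:
  assumes u: "u \<in> verts G" and deg: "out_degree G u > 0"
  defines "n \<equiv> real (card (verts G))"
  shows "(n - 1) * (weight_bound - row_weight u) =
     (\<Sum>w\<in>verts G - insert u (neighbours G u). real (out_degree G w) - 1) +
     (n - 1 - real (out_degree G u)) / real (out_degree G u) *
       (\<Sum>v\<in>neighbours G u. n - 1 - real (out_degree G v))"
proof -
  let ?W = "verts G - insert u (neighbours G u)"
  define D where "D = real (out_degree G u)"
  define s where "s = (\<Sum>v\<in>neighbours G u. real (out_degree G v))"
  define t where "t = (\<Sum>w\<in>?W. real (out_degree G w))"
  have D: "D > 0" using deg by (simp add: D_def)
  have cN: "real (card (neighbours G u)) = D" by (simp add: D_def out_degree_neighbours)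
  have nu: "u \<notin> neighbours G u" using neighbours_subset by blast
  have V: "verts G = insert u (neighbours G u) \<union> ?W" using u neighbours_subset by auto
  have "card (verts G) = card (insert u (neighbours G u)) + card ?W"
    by (subst V, subst card_Un_disjoint) auto
  then have cW: "real (card ?W) = n - 1 - D" using nu cN by (simp add: n_def)
  have "D \<le> n - 1" using cW by (metis of_nat_0_le_iff diff_ge_0_iff_ge)
  then have n: "n - 1 > 0" using D by simp
  have "2 * real (num_edges G) = (\<Sum>v\<in>verts G. real (out_degree G v))"
    by (metis of_nat_mult of_nat_numeral of_nat_sum sum_out_degree)
  also have "\<dots> = (\<Sum>v\<in>insert u (neighbours G u). real (out_degree G v)) + t"
    unfolding t_def by (subst V, subst sum.union_disjoint) auto
  finally have m: "2 * real (num_edges G) = D + s + t" using nu by (simp add: D_def s_def)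
  \<comment> \<open>The average neighbour degree. Writing \<open>s\<close> as \<open>r * D\<close>
    clears the denominators.\<close>
  define r where "r = s / D"
  have s: "s = r * D" using D by (simp add: r_def)
  have wb: "(n - 1) * weight_bound = D + s + t + (n - 1) * (n - 2)"
    using n unfolding weight_bound_def n_def[symmetric] m by (simp add: field_simps)
  have rw: "row_weight u = D + r"
    unfolding row_weight_def D_def r_def s_def ..
  have "(n - 1 - D) / D * (D * (n - 1) - s) = (n - 1 - D) * (n - 1 - r)"
    using D by (simp add: s field_simps)
  then have "(n - 1) * (weight_bound - row_weight u) =
      (t - (n - 1 - D)) + (n - 1 - D) / D * (D * (n - 1) - s)"
    unfolding right_diff_distrib wb rw by (simp add: s algebra_simps)
  also have "t - (n - 1 - D) = (\<Sum>w\<in>?W. real (out_degree G w) - 1)"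
    using cW by (simp add: sum_subtractf t_def)
  also have "D * (n - 1) - s = (\<Sum>v\<in>neighbours G u. n - 1 - real (out_degree G v))"
    using cN by (simp add: sum_subtractf s_def)
  finally show ?thesis by (simp add: D_def)
qed

end

section \<open>Row sum bound and de Caen's inequality for connected graphs\<close>

locale nontrivial_connected_graph = graph +
  assumes conn: "Digraph_Component.connected G"
    and two_verts: "card (verts G) \<ge> 2"
begin

lemma deg_pos: "u \<in> verts G \<Longrightarrow> out_degree G u > 0"
  by (rule connected_out_degree_pos[OF conn two_verts])

lemma deg_ge_1: "u \<in> verts G \<Longrightarrow> real (out_degree G u) \<ge> 1"
  using deg_pos[of u] by simp

lemma deg_le_real: "u \<in> verts G \<Longrightarrow> real (out_degree G u) \<le> real (card (verts G)) - 1"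
  using out_degree_le[of u] two_verts by linarith

lemma row_weight_le:
  assumes u: "u \<in> verts G"
  shows "row_weight u \<le> weight_bound"
proof -
  let ?n = "real (card (verts G))"
  have "(\<Sum>w\<in>verts G - insert u (neighbours G u). real (out_degree G w) - 1) \<ge> 0"
    using deg_ge_1 by (intro sum_nonneg) auto
  moreover have "(\<Sum>v\<in>neighbours G u. ?n - 1 - real (out_degree G v)) \<ge> 0"
    using deg_le_real[OF adj_in_verts(2)] by (intro sum_nonneg) auto
  moreover have "(?n - 1 - real (out_degree G u)) / real (out_degree G u) \<ge> 0"
    using deg_le_real[OF u] by simp
  ultimately have "(?n - 1) * (weight_bound - row_weight u) \<ge> 0"
    unfolding row_weight_slack[OF u deg_pos[OF u]] by (intro add_nonneg_nonneg mult_nonneg_nonneg)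
  then show ?thesis using two_verts by (simp add: zero_le_mult_iff)
qed

text \<open>If \<open>u\<close> misses some vertex, the factor \<open>?k\<close> of the slack
  formula is positive, so both sums vanish. Then non-neighbours of \<open>u\<close> are leaves and
  neighbours of \<open>u\<close> are adjacent to everything, which leaves only a star with
  \<open>u\<close> as a leaf.\<close>

lemma row_weight_eq_bound_cases:
  assumes u: "u \<in> verts G" and eq: "row_weight u = weight_bound"
  shows "neighbours G u = verts G - {u} \<or>
    (\<exists>c\<in>verts G. u \<noteq> c \<and> card (verts G) \<ge> 3 \<and> (\<forall>v\<in>verts G - {c}. neighbours G v = {c}))"
proof (cases "neighbours G u = verts G - {u}")
  case not_full: False
  let ?n = "real (card (verts G))" and ?W = "verts G - insert u (neighbours G u)"
  let ?S = "\<Sum>w\<in>?W. real (out_degree G w) - 1"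
  let ?T = "\<Sum>v\<in>neighbours G u. ?n - 1 - real (out_degree G v)"
  let ?k = "(?n - 1 - real (out_degree G u)) / real (out_degree G u)"
  have "out_degree G u \<noteq> card (verts G) - 1" using neighbours_eq_if_full[OF u] not_full by blast
  then have k: "?k > 0" using deg_pos[OF u] out_degree_le[OF u] by simp
  have S: "?S \<ge> 0" using deg_ge_1 by (intro sum_nonneg) auto
  have T: "?T \<ge> 0" using deg_le_real[OF adj_in_verts(2)] by (intro sum_nonneg) auto
  have "?S + ?k * ?T = 0" using row_weight_slack[OF u deg_pos[OF u]] eq by simp
  then have "?S = 0" "?k * ?T = 0" using S T k
    by (smt (verit) mult_nonneg_nonneg)+
  then have "?T = 0" using k by (metis less_irrefl mult_eq_0_iff)
  have leaf: "out_degree G w = 1" if "w \<in> ?W" for w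
  proof -
    have "\<forall>w\<in>?W. real (out_degree G w) - 1 = 0"
      using \<open>?S = 0\<close> deg_ge_1 by (subst (asm) sum_nonneg_eq_0_iff) auto
    then show ?thesis using that by auto
  qed
  have full: "neighbours G v = verts G - {v}" if "v \<in> neighbours G u" for v
  proof -
    have v: "v \<in> verts G" using that neighbours_subset by blast
    have "\<forall>v\<in>neighbours G u. ?n - 1 - real (out_degree G v) = 0"
      using \<open>?T = 0\<close> deg_le_real[OF adj_in_verts(2)] by (subst (asm) sum_nonneg_eq_0_iff) auto
    then have "real (out_degree G v) = ?n - 1" using that by force
    then have "out_degree G v = card (verts G) - 1" by linarith
    then show ?thesis by (rule neighbours_eq_if_full[OF v])
  qed
  have "neighbours G u \<noteq> {}" using deg_pos[OF u] by (auto simp: out_degree_neighbours)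
  then obtain c where c: "c \<in> neighbours G u" by blast
  have cV: "c \<in> verts G" "c \<noteq> u" using c neighbours_subset by blast+
  \<comment> \<open>This non-neighbour forces \<open>u\<close> to have a single neighbour and also
    serves as the third vertex.\<close>
  obtain w where w: "w \<in> ?W" using not_full neighbours_subset[of u] by blast
  have leaf_c: "neighbours G x = {c}" if x: "x \<in> ?W" for x
  proof -
    have "x \<noteq> c" using x c by auto
    then have "x \<in> neighbours G c" unfolding full[OF c] using x by simp
    then have "c \<in> neighbours G x" using adj_commute[of c x] by simp
    moreover have "card (neighbours G x) = 1" using leaf[OF x] by (simp add: out_degree_neighbours)
    ultimately show ?thesis by (metis card_1_singletonE singletonD)
  qed
  \<comment> \<open>The leaf \<open>w\<close> is adjacent to every neighbour of \<open>u\<close> but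
    has only the neighbour \<open>c\<close>.\<close>
  have "v = c" if v: "v \<in> neighbours G u" for v
  proof -
    have "w \<in> neighbours G v" unfolding full[OF v] using w v by auto
    then have "v \<in> neighbours G w" using adj_commute[of v w] by simp
    then show ?thesis using leaf_c[OF w] by simp
  qed
  then have "neighbours G u = {c}" using c by blast
  then have star: "\<forall>v\<in>verts G - {c}. neighbours G v = {c}" using leaf_c by auto
  have "card {u, c, w} \<le> card (verts G)" using u cV w by (intro card_mono) auto
  moreover have "w \<noteq> u" "w \<noteq> c" using w c by blast+
  then have "card {u, c, w} = 3" using cV(2) by simp
  ultimately have three: "card (verts G) \<ge> 3" by simp
  show ?thesis using cV(2) by (intro disjI2 bexI[of _ c] conjI three star cV(1)) simp
qed simp

lemma sum_deg_row_weight: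
  "(\<Sum>u\<in>verts G. real (out_degree G u) * row_weight u) = 2 * (\<Sum>u\<in>verts G. (real (out_degree G u))\<^sup>2)"
proof -
  have "(\<Sum>u\<in>verts G. real (out_degree G u) * row_weight u) =
      (\<Sum>u\<in>verts G. (real (out_degree G u))\<^sup>2 + (\<Sum>v\<in>neighbours G u. real (out_degree G v)))"
    using deg_pos by (intro sum.cong refl) (auto simp: row_weight_def field_simps power2_eq_square)
  then show ?thesis
    by (simp add: sum.distrib sum_neighbours power2_eq_square)
qed

text \<open>Twice the defect in de Caen's inequality is a weighted sum of the row slacks. As the
  weights are positive, the inequality follows and equality makes every row tight.\<close>

lemma sum_degree_square_slack:
  "(\<Sum>u\<in>verts G. real (out_degree G u) * (weight_bound - row_weight u)) =
     2 * (real (num_edges G) * weight_bound - (\<Sum>u\<in>verts G. (real (out_degree G u))\<^sup>2))"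
proof -
  have "real (\<Sum>u\<in>verts G. out_degree G u) = 2 * real (num_edges G)"
    unfolding sum_out_degree by simp
  then have "(\<Sum>u\<in>verts G. real (out_degree G u)) * weight_bound = 2 * real (num_edges G) * weight_bound"
    by simp
  then show ?thesis
    by (simp add: right_diff_distrib sum_subtractf sum_deg_row_weight flip: sum_distrib_right)
qed

lemma sum_degree_square_le:
  "(\<Sum>u\<in>verts G. (real (out_degree G u))\<^sup>2) \<le> real (num_edges G) * weight_bound"
proof -
  have "(\<Sum>u\<in>verts G. real (out_degree G u) * (weight_bound - row_weight u)) \<ge> 0"
    using row_weight_le by (intro sum_nonneg) simp
  then show ?thesis unfolding sum_degree_square_slack by simp
qed

lemma sum_degree_square_eqD:
  assumes "(\<Sum>u\<in>verts G. (real (out_degree G u))\<^sup>2) = real (num_edges G) * weight_bound"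
    and "u \<in> verts G"
  shows "row_weight u = weight_bound"
proof -
  have "(\<Sum>u\<in>verts G. real (out_degree G u) * (weight_bound - row_weight u)) = 0"
    unfolding sum_degree_square_slack using assms(1) by simp
  then have "\<forall>u\<in>verts G. real (out_degree G u) * (weight_bound - row_weight u) = 0"
    using row_weight_le by (subst (asm) sum_nonneg_eq_0_iff) auto
  then show ?thesis using assms(2) deg_pos[of u] by auto
qed

end

section \<open>The signless Laplacian and its spectrum in terms of vertices\<close>

context graph
begin

lemma signless_laplacian_carrier: "signless_laplacian G vs \<in> carrier_mat (length vs) (length vs)"
  by (simp add: signless_laplacian_def degree_mat_def adjacency_mat_def)

lemma signless_laplacian_index:
  assumes "i < length vs" "j < length vs"
  shows "signless_laplacian G vs $$ (i, j) =
    (if i = j then real (out_degree G (vs ! i)) else 0) + (if vs ! i \<rightarrow> vs ! j then 1 else 0)"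
  using assms by (simp add: signless_laplacian_def degree_mat_def adjacency_mat_def mat_diag_def)

lemma signless_laplacian_sym:
  assumes "i < length vs" "j < length vs"
  shows "signless_laplacian G vs $$ (i, j) = signless_laplacian G vs $$ (j, i)"
  using assms by (simp add: signless_laplacian_index adj_commute[of "vs ! i" "vs ! j"])

context
  fixes vs :: "'a list"
  assumes dist: "distinct vs" and set_vs: "set vs = verts G"
begin

lemma sum_nth_verts: "(\<Sum>i<length vs. f (vs ! i)) = (\<Sum>u\<in>verts G. f u)"
  using dist set_vs by (intro sum.reindex_bij_betw bij_betw_nth) auto

lemma length_vs: "length vs = card (verts G)"
  using distinct_card[OF dist] set_vs by simp

lemma sum_adj: "(\<Sum>v\<in>verts G. if u \<rightarrow> v then f v else (0 :: real)) = (\<Sum>v\<in>neighbours G u. f v)"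
  using neighbours_subset[of u] by (intro sum.mono_neutral_cong_right) auto

lemma signless_laplacian_row:
  assumes i: "i < length vs"
  shows "(\<Sum>j<length vs. signless_laplacian G vs $$ (i, j) * x (vs ! j)) =
    real (out_degree G (vs ! i)) * x (vs ! i) + (\<Sum>v\<in>neighbours G (vs ! i). x v)"
proof -
  have "(\<Sum>j<length vs. signless_laplacian G vs $$ (i, j) * x (vs ! j)) =
      (\<Sum>j<length vs. (if i = j then real (out_degree G (vs ! i)) * x (vs ! i) else 0) +
        (if vs ! i \<rightarrow> vs ! j then x (vs ! j) else 0))"
    using i by (intro sum.cong refl) (auto simp: signless_laplacian_index algebra_simps)
  then show ?thesis
    using i sum_nth_verts[of "\<lambda>v. if vs ! i \<rightarrow> v then x v else 0"]
    by (simp add: sum.distrib sum_adj)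
qed

text \<open>Eigenvectors become functions on vertices, so that later eigenvector arguments need no
  positions in \<open>vs\<close>.\<close>

lemma signless_spectrum_iff:
  "l \<in># signless_spectrum G vs \<longleftrightarrow>
    (\<exists>x. (\<exists>u\<in>verts G. x u \<noteq> 0) \<and>
       (\<forall>u\<in>verts G. real (out_degree G u) * x u + (\<Sum>v\<in>neighbours G u. x v) = l * x u))"
proof -
  let ?Q = "signless_laplacian G vs" and ?n = "length vs"
  note Q = signless_laplacian_carrier[of vs]
  have mult: "(?Q *\<^sub>v v) $ i = (\<Sum>j<?n. ?Q $$ (i, j) * v $ j)" if "i < ?n" "v \<in> carrier_vec ?n" for i v
    using Q that by (auto simp: scalar_prod_def lessThan_atLeast0 intro!: sum.cong)
  have nth: "\<exists>i<?n. u = vs ! i" if "u \<in> verts G" for u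
    using that set_vs by (metis in_set_conv_nth)
  have "l \<in># signless_spectrum G vs \<longleftrightarrow> eigenvalue ?Q l"
    unfolding signless_spectrum_def by (rule set_proots_char_poly[OF Q])
  also have "\<dots> \<longleftrightarrow> (\<exists>x. (\<exists>u\<in>verts G. x u \<noteq> 0) \<and>
       (\<forall>u\<in>verts G. real (out_degree G u) * x u + (\<Sum>v\<in>neighbours G u. x v) = l * x u))"
  proof
    assume "eigenvalue ?Q l"
    then obtain v where v: "v \<in> carrier_vec ?n" "v \<noteq> 0\<^sub>v ?n" "?Q *\<^sub>v v = l \<cdot>\<^sub>v v"
      using Q unfolding eigenvalue_def eigenvector_def by auto
    \<comment> \<open>Reindexes \<open>v\<close> by vertices; distinctness of \<open>vs\<close>
      makes the position of a vertex unique.\<close>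
    define x where "x u = v $ (inv_into {..<?n} ((!) vs) u)" for u
    have x: "x (vs ! i) = v $ i" if "i < ?n" for i
      unfolding x_def using inj_on_nth[OF dist] that by (subst inv_into_f_f) auto
    have "real (out_degree G u) * x u + (\<Sum>v\<in>neighbours G u. x v) = l * x u" if u: "u \<in> verts G" for u
    proof -
      obtain i where i: "i < ?n" "u = vs ! i" using nth[OF u] by blast
      have "(?Q *\<^sub>v v) $ i = (\<Sum>j<?n. ?Q $$ (i, j) * x (vs ! j))"
        using x by (simp add: mult[OF i(1) v(1)])
      then show ?thesis using v i x[OF i(1)] by (simp add: signless_laplacian_row)
    qed
    moreover obtain i where "i < ?n" "v $ i \<noteq> 0" using v by (auto simp: vec_eq_iff)
    then have "\<exists>u\<in>verts G. x u \<noteq> 0" using x set_vs by (metis nth_mem)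
    ultimately show "\<exists>x. (\<exists>u\<in>verts G. x u \<noteq> 0) \<and>
       (\<forall>u\<in>verts G. real (out_degree G u) * x u + (\<Sum>v\<in>neighbours G u. x v) = l * x u)" by blast
  next
    assume "\<exists>x. (\<exists>u\<in>verts G. x u \<noteq> 0) \<and>
       (\<forall>u\<in>verts G. real (out_degree G u) * x u + (\<Sum>v\<in>neighbours G u. x v) = l * x u)"
    then obtain x u where u: "u \<in> verts G" "x u \<noteq> 0"
      and x: "\<And>u. u \<in> verts G \<Longrightarrow> real (out_degree G u) * x u + (\<Sum>v\<in>neighbours G u. x v) = l * x u"
      by blast
    define v where "v = vec ?n (\<lambda>i. x (vs ! i))"
    have v: "v \<in> carrier_vec ?n" by (simp add: v_def)
    obtain i where "i < ?n" "u = vs ! i" using nth[OF u(1)] by blast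
    then have "v $ i \<noteq> 0\<^sub>v ?n $ i" using u by (simp add: v_def)
    then have "v \<noteq> 0\<^sub>v ?n" by auto
    moreover have "?Q *\<^sub>v v = l \<cdot>\<^sub>v v"
    proof (rule eq_vecI)
      fix i assume "i < dim_vec (l \<cdot>\<^sub>v v)"
      then have i: "i < ?n" by (simp add: v_def)
      have "(?Q *\<^sub>v v) $ i = (\<Sum>j<?n. ?Q $$ (i, j) * x (vs ! j))"
        unfolding mult[OF i v] by (simp add: v_def)
      moreover have "vs ! i \<in> verts G" using i set_vs by (metis nth_mem)
      ultimately show "(?Q *\<^sub>v v) $ i = (l \<cdot>\<^sub>v v) $ i"
        using i x[of "vs ! i"] by (simp add: signless_laplacian_row v_def)
    qed (use Q v in auto)
    ultimately show "eigenvalue ?Q l"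
      using v Q unfolding eigenvalue_def eigenvector_def by auto
  qed
  finally show ?thesis .
qed

lemma size_signless_spectrum: "size (signless_spectrum G vs) = card (verts G)"
  unfolding signless_spectrum_def length_vs[symmetric]
  by (rule size_proots_char_poly_symmetric[OF signless_laplacian_carrier signless_laplacian_sym])

text \<open>The trace of Q is the degree sum, since without loops the adjacency matrix has zero
  diagonal.\<close>

lemma sum_signless_spectrum: "(\<Sum>x\<in>#signless_spectrum G vs. x) = 2 * real (num_edges G)"
proof -
  have "(\<Sum>x\<in>#signless_spectrum G vs. x) = (\<Sum>i<length vs. signless_laplacian G vs $$ (i, i))"
    unfolding signless_spectrum_def
    by (rule sum_proots_char_poly_symmetric[OF signless_laplacian_carrier signless_laplacian_sym])
  also have "\<dots> = (\<Sum>i<length vs. real (out_degree G (vs ! i)))"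
    using adj_not_same by (intro sum.cong refl) (auto simp: signless_laplacian_index)
  also have "\<dots> = real (\<Sum>u\<in>verts G. out_degree G u)"
    using sum_nth_verts[of "\<lambda>u. real (out_degree G u)"] by simp
  finally show ?thesis unfolding sum_out_degree by simp
qed

text \<open>A row of Q belonging to a vertex of degree d has the diagonal entry d and exactly d
  further entries 1, hence contributes d^2 + d.\<close>

lemma sum_sq_signless_spectrum:
  "(\<Sum>x\<in>#signless_spectrum G vs. x\<^sup>2) =
     (\<Sum>u\<in>verts G. (real (out_degree G u))\<^sup>2) + 2 * real (num_edges G)"
proof -
  have row: "(\<Sum>j<length vs. (signless_laplacian G vs $$ (i, j))\<^sup>2) =
      (real (out_degree G (vs ! i)))\<^sup>2 + real (out_degree G (vs ! i))" if i: "i < length vs" for i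
  proof -
    have "(\<Sum>j<length vs. (signless_laplacian G vs $$ (i, j))\<^sup>2) =
        (\<Sum>j<length vs. (if i = j then (real (out_degree G (vs ! i)))\<^sup>2 else 0) +
          (if vs ! i \<rightarrow> vs ! j then 1 else 0))"
      using i adj_not_same by (intro sum.cong refl) (auto simp: signless_laplacian_index)
    then show ?thesis
      using i sum_nth_verts[of "\<lambda>v. if vs ! i \<rightarrow> v then 1 else (0 :: real)"]
      by (simp add: sum.distrib sum_adj out_degree_neighbours)
  qed
  have "(\<Sum>x\<in>#signless_spectrum G vs. x\<^sup>2) =
      (\<Sum>i<length vs. \<Sum>j<length vs. (signless_laplacian G vs $$ (i, j))\<^sup>2)"
    unfolding signless_spectrum_def
    by (rule sum_sq_proots_char_poly_symmetric[OF signless_laplacian_carrier signless_laplacian_sym])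
  also have "\<dots> = (\<Sum>i<length vs. (real (out_degree G (vs ! i)))\<^sup>2 + real (out_degree G (vs ! i)))"
    using row by simp
  also have "\<dots> = (\<Sum>u\<in>verts G. (real (out_degree G u))\<^sup>2) + real (\<Sum>u\<in>verts G. out_degree G u)"
    using sum_nth_verts[of "\<lambda>u. (real (out_degree G u))\<^sup>2 + real (out_degree G u)"]
    by (simp add: sum.distrib)
  finally show ?thesis unfolding sum_out_degree by simp
qed

end

end

section \<open>The energy bound\<close>

lemma sum_mset_affine: "(\<Sum>x\<in>#M. a + b * x :: real) = a * real (size M) + b * (\<Sum>x\<in>#M. x)"
  by (induction M) (auto simp: algebra_simps)

lemma sum_mset_le_bound:
  assumes "\<And>x. x \<in># M \<Longrightarrow> x \<le> (c :: real)"
  shows "(\<Sum>x\<in>#M. x) \<le> real (size M) * c"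
  using assms
proof (induction M)
  case (add x M)
  then have "(\<Sum>x\<in>#M. x) \<le> real (size M) * c" "x \<le> c" by simp_all
  then show ?case by (simp add: algebra_simps)
qed simp

text \<open>The line interpolating the absolute deviation from n - 1 at n - 2 and 2n - 2, where it
  takes the values 1 and n - 1. These two points are the only possible eigenvalues for a complete
  graph on n vertices.\<close>

lemma abs_deviation_affine:
  fixes n l :: real
  assumes "n \<ge> 2" "l = n - 2 \<or> l = 2 * n - 2"
  shows "\<bar>l - (n - 1)\<bar> = (1 - (n - 2) * (n - 2) / n) + (n - 2) / n * l"
  using assms(2)
proof
  assume l: "l = n - 2"
  show ?thesis using assms(1) unfolding l by (simp add: field_simps)
next
  assume l: "l = 2 * n - 2"
  show ?thesis using assms(1) unfolding l by (simp add: field_simps)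
qed

text \<open>Intended reading: \<open>a\<close> and \<open>b\<close> are the largest eigenvalue and
  its bound, both minus the average; \<open>T\<close> is the rest of the energy; \<open>S\<close>
  and \<open>S'\<close> are the squared deviation and its bound. Three estimates are chained, so
  equality makes each of them tight.\<close>

lemma energy_bound_real:
  fixes a b n R S S' T :: real
  assumes n: "n > 1" and ab: "0 \<le> a" "a \<le> b" and T: "T \<ge> 0" "T\<^sup>2 \<le> (n - 1) * (S - a\<^sup>2)" and SS: "S \<le> S'"
  shows "a + T \<le> b + sqrt ((n - 1) * (S' - a\<^sup>2))"
    and "a + T = b + sqrt ((n - 1) * (S' - a\<^sup>2)) \<Longrightarrow> a = b \<and> S = S' \<and> T\<^sup>2 = (n - 1) * (S - a\<^sup>2)"
proof -
  have mono: "(n - 1) * (S - a\<^sup>2) \<le> (n - 1) * (S' - a\<^sup>2)"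
    using n SS by (intro mult_left_mono) auto
  then have T2: "T\<^sup>2 \<le> (n - 1) * (S' - a\<^sup>2)" using T(2) by linarith
  then have le: "T \<le> sqrt ((n - 1) * (S' - a\<^sup>2))" by (rule real_le_rsqrt)
  then show "a + T \<le> b + sqrt ((n - 1) * (S' - a\<^sup>2))" using ab by simp
  assume "a + T = b + sqrt ((n - 1) * (S' - a\<^sup>2))"
  then have "a = b" "T = sqrt ((n - 1) * (S' - a\<^sup>2))" using le ab by auto
  \<comment> \<open>By \<open>T2\<close> the radicand is nonnegative, so squaring the root gives it
    back.\<close>
  moreover from this(2) have "T\<^sup>2 = (n - 1) * (S' - a\<^sup>2)"
    using T2 by (metis order_trans real_sqrt_pow2 zero_le_power2)
  ultimately show "a = b \<and> S = S' \<and> T\<^sup>2 = (n - 1) * (S - a\<^sup>2)"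
    using mono T(2) n by auto
qed

section \<open>Complete graphs up to isomorphism\<close>

context graph
begin

text \<open>An isomorphism is injective on vertices, so adjacency of distinct vertices pulls back.
  Conversely any bijection of the vertices onto an initial segment works, as arcs are determined by
  their ends.\<close>

lemma digraph_iso_complete_graph_iff:
  "digraph_iso G (complete_graph (card (verts G))) \<longleftrightarrow> (\<forall>u\<in>verts G. neighbours G u = verts G - {u})"
proof
  assume "digraph_iso G (complete_graph (card (verts G)))"
  then obtain f where f: "digraph_isomorphism f" and eq: "complete_graph (card (verts G)) = app_iso f G"
    unfolding digraph_iso_def by blast
  have V: "{..<card (verts G)} = iso_verts f ` verts G"
    using arg_cong[OF eq, of verts] by (simp add: complete_graph_def)
  have E: "{(u, v). u < card (verts G) \<and> v < card (verts G) \<and> u \<noteq> v} =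
      (\<lambda>(u, v). (iso_verts f u, iso_verts f v)) ` arcs_ends G"
    using arg_cong[OF eq, of arcs_ends] arcs_ends_app_iso_eq[OF f] by (simp add: complete_graph_def)
  have "u \<rightarrow> v" if uv: "u \<in> verts G" "v \<in> verts G" "u \<noteq> v" for u v
  proof -
    have "iso_verts f u \<in> {..<card (verts G)}" "iso_verts f v \<in> {..<card (verts G)}"
      unfolding V using uv by auto
    moreover have "iso_verts f u \<noteq> iso_verts f v" using uv iso_verts_eq_iff[OF f] by blast
    ultimately have "(iso_verts f u, iso_verts f v) \<in>
        (\<lambda>(u, v). (iso_verts f u, iso_verts f v)) ` arcs_ends G"
      unfolding E[symmetric] by simp
    then obtain u' v' where uv': "u' \<rightarrow> v'" "iso_verts f u = iso_verts f u'" "iso_verts f v = iso_verts f v'"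
      by auto
    then have "u = u'" "v = v'" using uv adj_in_verts[OF uv'(1)] iso_verts_eq_iff[OF f] by blast+
    then show ?thesis using uv' by simp
  qed
  then show "\<forall>u\<in>verts G. neighbours G u = verts G - {u}"
    using neighbours_subset by (auto simp: neighbours_def)
next
  assume K: "\<forall>u\<in>verts G. neighbours G u = verts G - {u}"
  obtain h where h: "bij_betw h (verts G) {0..<card (verts G)}"
    using ex_bij_betw_finite_nat[OF finite_verts] by blast
  then have inj: "inj_on h (verts G)" and img: "h ` verts G = {..<card (verts G)}"
    by (auto simp: bij_betw_def lessThan_atLeast0)
  \<comment> \<open>Arcs of \<open>complete_graph\<close> are pairs, so each arc goes to the pair of
    its relabelled ends, with \<open>fst\<close> and \<open>snd\<close> as new tail and
    head.\<close>
  define f where "f = \<lparr>iso_verts = h, iso_arcs = (\<lambda>a. (h (tail G a), h (head G a))),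
    iso_head = snd, iso_tail = fst\<rparr>"
  have "inj_on (iso_arcs f) (arcs G)"
  proof (rule inj_onI)
    fix a b assume ab: "a \<in> arcs G" "b \<in> arcs G" "iso_arcs f a = iso_arcs f b"
    then have "tail G a = tail G b" "head G a = head G b"
      using inj by (auto simp: f_def dest: inj_onD)
    then show "a = b" using ab no_multi_arcs by (auto simp: arc_to_ends_def)
  qed
  then have iso: "digraph_isomorphism f"
    unfolding digraph_isomorphism_def using inj wf_digraph by (auto simp: f_def)
  have "iso_arcs f ` arcs G = (\<lambda>(u, v). (h u, h v)) ` arcs_ends G"
    by (auto simp: f_def arcs_ends_conv image_image)
  also have "arcs_ends G = {(u, v). u \<in> verts G \<and> v \<in> verts G \<and> u \<noteq> v}"
  proof (intro equalityI subrelI)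
    fix u v assume "u \<rightarrow> v"
    then show "(u, v) \<in> {(u, v). u \<in> verts G \<and> v \<in> verts G \<and> u \<noteq> v}"
      using adj_in_verts adj_not_same by blast
  next
    fix u v assume "(u, v) \<in> {(u, v). u \<in> verts G \<and> v \<in> verts G \<and> u \<noteq> v}"
    then have "v \<in> neighbours G u" using K by auto
    then show "u \<rightarrow> v" by simp
  qed
  also have "(\<lambda>(u, v). (h u, h v)) ` \<dots> =
      {(i, j). i \<in> h ` verts G \<and> j \<in> h ` verts G \<and> i \<noteq> j}"
    using inj by (auto simp: inj_on_eq_iff image_iff)
  finally have "iso_arcs f ` arcs G =
      {(i, j). i < card (verts G) \<and> j < card (verts G) \<and> i \<noteq> j}"
    unfolding img by simp
  then have "complete_graph (card (verts G)) = app_iso f G"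
    using img by (simp add: complete_graph_def with_proj_def app_iso_def) (simp add: f_def)
  then show "digraph_iso G (complete_graph (card (verts G)))"
    unfolding digraph_iso_def using iso by blast
qed

end

section \<open>The upper bound on the energy and its equality case\<close>

locale enumerated_graph = nontrivial_connected_graph +
  fixes vs :: "'a list"
  assumes dist: "distinct vs" and set_vs: "set vs = verts G"
begin

abbreviation "spec \<equiv> signless_spectrum G vs"
abbreviation "radius \<equiv> signless_radius G vs"
abbreviation "avg \<equiv> 2 * real (num_edges G) / real (card (verts G))"

lemmas spec_iff = signless_spectrum_iff[OF dist set_vs]
  and size_spec = size_signless_spectrum[OF dist set_vs]
  and sum_spec = sum_signless_spectrum[OF dist set_vs]
  and sum_sq_spec = sum_sq_signless_spectrum[OF dist set_vs]

lemma radius_in_spec: "radius \<in># spec"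
  and spec_le_radius: "x \<in># spec \<Longrightarrow> x \<le> radius"
proof -
  have "spec \<noteq> {#}" using size_spec two_verts by auto
  then show "radius \<in># spec" unfolding signless_radius_def by (intro Max_in) auto
  show "x \<in># spec \<Longrightarrow> x \<le> radius" unfolding signless_radius_def by (intro Max_ge) auto
qed

text \<open>Gershgorin-type argument for D^-1 Q D, whose eigenvector is D^-1 x: at a vertex
  \<open>u\<close> where its entry \<open>?r u\<close> is largest, the eigenvalue equation gives l
  \<le> \<open>row_weight u\<close>.\<close>

lemma spec_le_weight_bound:
  assumes "l \<in># spec"
  shows "l \<le> weight_bound"
proof -
  obtain x z where z: "z \<in> verts G" "x z \<noteq> 0"
    and ev: "\<And>u. u \<in> verts G \<Longrightarrow> real (out_degree G u) * x u + (\<Sum>v\<in>neighbours G u. x v) = l * x u"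
    using assms unfolding spec_iff by blast
  let ?r = "\<lambda>u. \<bar>x u\<bar> / real (out_degree G u)"
  have "Max (?r ` verts G) \<in> ?r ` verts G" using z by (intro Max_in) auto
  then obtain u where u: "u \<in> verts G" and umax: "?r u = Max (?r ` verts G)" by auto
  have max: "?r v \<le> ?r u" if "v \<in> verts G" for v unfolding umax using that by simp
  have "?r z > 0" using z deg_pos[OF z(1)] by simp
  then have "?r u > 0" using max[OF z(1)] by linarith
  then have xu: "\<bar>x u\<bar> > 0" by (auto simp: zero_less_divide_iff)
  have nb: "\<bar>x v\<bar> \<le> ?r u * real (out_degree G v)" if "v \<in> neighbours G u" for v
  proof -
    have "v \<in> verts G" using that neighbours_subset by blast
    then show ?thesis using max[of v] deg_pos[of v] by (simp add: field_simps)
  qed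
  have "l * \<bar>x u\<bar> \<le> \<bar>l * x u\<bar>" by (simp add: abs_mult mult_right_mono)
  also have "\<dots> = \<bar>real (out_degree G u) * x u + (\<Sum>v\<in>neighbours G u. x v)\<bar>"
    by (simp add: ev[OF u])
  also have "\<dots> \<le> real (out_degree G u) * \<bar>x u\<bar> + (\<Sum>v\<in>neighbours G u. \<bar>x v\<bar>)"
    by (rule order_trans[OF abs_triangle_ineq]) (simp add: abs_mult sum_abs)
  also have "\<dots> \<le> real (out_degree G u) * \<bar>x u\<bar> + (\<Sum>v\<in>neighbours G u. ?r u * real (out_degree G v))"
    by (intro add_left_mono sum_mono nb)
  also have "\<dots> = row_weight u * \<bar>x u\<bar>"
    unfolding row_weight_def sum_distrib_left[symmetric] by (simp add: algebra_simps)
  finally have "l \<le> row_weight u" using xu by simp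
  then show ?thesis using row_weight_le[OF u] by linarith
qed

lemma avg_ge_1: "avg \<ge> 1"
proof -
  have "real (card (verts G)) = (\<Sum>u\<in>verts G. 1)" by simp
  also have "\<dots> \<le> (\<Sum>u\<in>verts G. real (out_degree G u))" by (intro sum_mono deg_ge_1)
  also have "\<dots> = real (\<Sum>u\<in>verts G. out_degree G u)" by simp
  finally show ?thesis using two_verts unfolding sum_out_degree by (simp add: field_simps)
qed

text \<open>The mean of the eigenvalues is at most their maximum. This removes the absolute value
  from the energy term of \<open>radius\<close>.\<close>

lemma avg_le_radius: "avg \<le> radius"
  using sum_mset_le_bound[of spec radius] spec_le_radius two_verts
  unfolding sum_spec size_spec by (simp add: field_simps)

definition "deviation = (\<Sum>x\<in>#spec. (x - avg)\<^sup>2)"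
text \<open>The value of \<open>deviation\<close> with de Caen's bound in place of the sum of
  squared degrees.\<close>

definition "deviation_bound =
  real (num_edges G) * weight_bound + 2 * real (num_edges G) - 2 * real (num_edges G) * avg"

lemma deviation_eq: "deviation =
  (\<Sum>u\<in>verts G. (real (out_degree G u))\<^sup>2) + 2 * real (num_edges G) - 2 * real (num_edges G) * avg"
  using two_verts
  unfolding deviation_def sum_mset_square_deviation sum_sq_spec size_spec
  by (simp add: sum_spec[simplified] power2_eq_square field_simps)

text \<open>Cauchy-Schwarz is applied to the n - 1 eigenvalues left after splitting off the largest;
  \<open>energy_bound_real\<close> combines it with the bounds on \<open>radius\<close> and
  \<open>deviation\<close>.\<close>

lemma
  defines "E \<equiv> signless_energy G vs"
    and "B \<equiv> (weight_bound - avg) + sqrt ((real (card (verts G)) - 1) * (deviation_bound - (radius - avg)\<^sup>2))"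
  shows energy_le: "E \<le> B"
    and energy_eqD: "E = B \<Longrightarrow> (\<forall>u\<in>verts G. row_weight u = weight_bound) \<and> radius = weight_bound \<and>
      (\<forall>x\<in>#spec. \<forall>y\<in>#spec. x \<noteq> radius \<longrightarrow> y \<noteq> radius \<longrightarrow> \<bar>x - avg\<bar> = \<bar>y - avg\<bar>)"
proof -
  let ?n = "real (card (verts G))"
  \<comment> \<open>A single copy of \<open>radius\<close> is removed, so \<open>R\<close> has n - 1
    elements whatever its multiplicity.\<close>
  define R where "R = spec - {#radius#}"
  define T where "T = (\<Sum>x\<in>#R. \<bar>x - avg\<bar>)"
  have spec: "spec = add_mset radius R" unfolding R_def using radius_in_spec by simp
  have sR: "real (size R) = ?n - 1" using size_spec unfolding spec by simp
  have E: "E = (radius - avg) + T"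
    using avg_le_radius unfolding E_def signless_energy_def spec T_def by simp
  have dev: "(\<Sum>x\<in>#R. \<bar>x - avg\<bar>\<^sup>2) = deviation - (radius - avg)\<^sup>2"
    unfolding deviation_def spec by simp
  note CS = sum_mset_Cauchy_Schwarz[of "\<lambda>x. \<bar>x - avg\<bar>" R, folded T_def, unfolded sR dev]
  have T0: "T \<ge> 0" unfolding T_def by (induction R) auto
  have dd: "deviation \<le> deviation_bound"
    using sum_degree_square_le unfolding deviation_eq deviation_bound_def by simp
  have n: "?n > 1" using two_verts by simp
  have ab: "0 \<le> radius - avg" "radius - avg \<le> weight_bound - avg"
    using avg_le_radius spec_le_weight_bound[OF radius_in_spec] by auto
  note main = energy_bound_real[OF n ab T0 CS(1) dd]
  show "E \<le> B" unfolding E B_def by (rule main(1))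
  assume "E = B"
  then have *: "radius - avg = weight_bound - avg" "deviation = deviation_bound"
    "T\<^sup>2 = (?n - 1) * (deviation - (radius - avg)\<^sup>2)"
    using main(2) unfolding E B_def by blast+
  have "(\<Sum>u\<in>verts G. (real (out_degree G u))\<^sup>2) = real (num_edges G) * weight_bound"
    using *(2) unfolding deviation_eq deviation_bound_def by simp
  then have "\<forall>u\<in>verts G. row_weight u = weight_bound" using sum_degree_square_eqD by blast
  moreover have "radius = weight_bound" using *(1) by simp
  moreover have "\<bar>x - avg\<bar> = \<bar>y - avg\<bar>" if "x \<in># spec" "y \<in># spec" "x \<noteq> radius" "y \<noteq> radius" for x y
  proof -
    have "x \<in># R" "y \<in># R" using that unfolding spec by simp_all
    then show ?thesis by (rule CS(2)[OF *(3)])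
  qed
  ultimately show "(\<forall>u\<in>verts G. row_weight u = weight_bound) \<and> radius = weight_bound \<and>
      (\<forall>x\<in>#spec. \<forall>y\<in>#spec. x \<noteq> radius \<longrightarrow> y \<noteq> radius \<longrightarrow> \<bar>x - avg\<bar> = \<bar>y - avg\<bar>)"
    by blast
qed

text \<open>For 0 the eigenvector is 1 at the centre and -1 at the leaves. For 1 it is the
  difference of the indicators of two leaves, which exist as there are at least three
  vertices.\<close>

lemma star_spec:
  assumes c: "c \<in> verts G" and card: "card (verts G) \<ge> 3"
    and star: "\<forall>v\<in>verts G - {c}. neighbours G v = {c}"
  shows "0 \<in># spec" and "1 \<in># spec"
proof -
  have Nc: "neighbours G c = verts G - {c}"
  proof
    show "verts G - {c} \<subseteq> neighbours G c"
    proof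
      fix v assume "v \<in> verts G - {c}"
      then have "c \<in> neighbours G v" using star by blast
      then show "v \<in> neighbours G c" using adj_commute[of v c] by simp
    qed
  qed (rule neighbours_subset)
  have deg1: "out_degree G v = 1" if "v \<in> verts G - {c}" for v
    using that star by (simp add: out_degree_neighbours)
  have "real (out_degree G u) * (if u = c then 1 else - 1) +
      (\<Sum>v\<in>neighbours G u. if v = c then 1 else - 1) = 0 * (if u = c then 1 else - 1 :: real)"
    if u: "u \<in> verts G" for u
  proof (cases "u = c")
    case True
    have "(\<Sum>v\<in>verts G - {c}. if v = c then 1 else - 1 :: real) = (\<Sum>v\<in>verts G - {c}. - 1)"
      by (intro sum.cong) auto
    then show ?thesis using True Nc by (simp add: out_degree_neighbours)
  next
    case False
    then show ?thesis using u star deg1 by simp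
  qed
  then show "0 \<in># spec" unfolding spec_iff using c by (intro exI[of _ "\<lambda>u. if u = c then 1 else - 1"]) auto
  have "card (verts G - {c}) \<ge> 2" using card c by simp
  then obtain a b where ab: "a \<in> verts G - {c}" "b \<in> verts G - {c}" "a \<noteq> b"
    by (metis card_le_Suc0_iff_eq finite_Diff finite_verts not_less_eq_eq numeral_2_eq_2)
  let ?x = "\<lambda>u. (if u = a then 1 else 0) - (if u = b then 1 else 0) :: real"
  have "real (out_degree G u) * ?x u + (\<Sum>v\<in>neighbours G u. ?x v) = 1 * ?x u"
    if u: "u \<in> verts G" for u
  proof (cases "u = c")
    case True
    have "(\<Sum>v\<in>verts G - {c}. ?x v) = 0" using ab by (simp add: sum_subtractf)
    then show ?thesis using True Nc ab by auto
  next
    case False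
    then show ?thesis using u star deg1 ab by auto
  qed
  moreover have "?x a \<noteq> 0" using ab by simp
  ultimately show "1 \<in># spec" unfolding spec_iff using ab(1) by (intro exI[of _ ?x]) blast
qed

lemma complete_if_energy_eq:
  assumes "signless_energy G vs =
    (weight_bound - avg) + sqrt ((real (card (verts G)) - 1) * (deviation_bound - (radius - avg)\<^sup>2))"
    and u: "u \<in> verts G"
  shows "neighbours G u = verts G - {u}"
proof (rule ccontr)
  assume "neighbours G u \<noteq> verts G - {u}"
  note eq = energy_eqD[OF assms(1)]
  then obtain c where c: "c \<in> verts G" and card: "card (verts G) \<ge> 3"
    and star: "\<forall>v\<in>verts G - {c}. neighbours G v = {c}"
    using row_weight_eq_bound_cases[OF u] \<open>neighbours G u \<noteq> verts G - {u}\<close> u by blast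
  \<comment> \<open>The aim is \<open>radius > 1\<close>: then 0 and 1 both differ from
    \<open>radius\<close> and must be equally far from \<open>avg\<close>, which would have to be
    1/2.\<close>
  have "real (num_edges G) > 0" using avg_ge_1 by (cases "num_edges G = 0") auto
  then have "2 * real (num_edges G) / (real (card (verts G)) - 1) > 0" using card by simp
  then have "weight_bound > 1" using card unfolding weight_bound_def by linarith
  then have "radius > 1" using eq by simp
  then have "\<bar>0 - avg\<bar> = \<bar>1 - avg\<bar>" using eq star_spec[OF c card star] by fastforce
  then show False using avg_ge_1 by linarith
qed

section \<open>Complete graphs attain the bound\<close>

context
  assumes complete: "\<And>u. u \<in> verts G \<Longrightarrow> neighbours G u = verts G - {u}"
begin

abbreviation "n \<equiv> real (card (verts G))"

lemma complete_degree: "u \<in> verts G \<Longrightarrow> real (out_degree G u) = n - 1"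
  using two_verts by (simp add: out_degree_neighbours complete of_nat_diff)

lemma complete_num_edges: "2 * real (num_edges G) = n * (n - 1)"
proof -
  have "2 * real (num_edges G) = real (\<Sum>u\<in>verts G. out_degree G u)"
    unfolding sum_out_degree by simp
  then show ?thesis by (simp add: complete_degree)
qed

text \<open>That is, Q = (n - 2) I + J with J the all-ones matrix.\<close>

lemma complete_row:
  fixes x :: "'a \<Rightarrow> real"
  assumes "u \<in> verts G"
  shows "real (out_degree G u) * x u + (\<Sum>v\<in>neighbours G u. x v) = (n - 2) * x u + (\<Sum>v\<in>verts G. x v)"
  using assms by (simp add: complete_degree complete sum_diff1 algebra_simps)

text \<open>Summing the eigenvalue equation over all vertices gives (l - (2n - 2)) times the sum of
  \<open>x\<close> equal to 0. If that sum vanishes, the equation at \<open>z\<close> leaves only l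
  = n - 2.\<close>

lemma complete_spec:
  assumes "l \<in># spec"
  shows "l = n - 2 \<or> l = 2 * n - 2"
proof (rule disjCI)
  assume ne: "l \<noteq> 2 * n - 2"
  obtain x z where z: "z \<in> verts G" "x z \<noteq> 0"
    and "\<And>u. u \<in> verts G \<Longrightarrow> real (out_degree G u) * x u + (\<Sum>v\<in>neighbours G u. x v) = l * x u"
    using assms unfolding spec_iff by blast
  then have ev: "(\<Sum>v\<in>verts G. x v) = (l - (n - 2)) * x u" if "u \<in> verts G" for u
    using complete_row[OF that, of x] that by (simp add: algebra_simps)
  have "(\<Sum>u\<in>verts G. (l - (n - 2)) * x u) = (\<Sum>u\<in>verts G. \<Sum>v\<in>verts G. x v)"
    by (intro sum.cong refl) (rule ev[symmetric])
  then have "(l - (n - 2)) * (\<Sum>v\<in>verts G. x v) = n * (\<Sum>v\<in>verts G. x v)"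
    by (simp add: sum_distrib_left)
  then have "(l - (2 * n - 2)) * (\<Sum>v\<in>verts G. x v) = 0"
    by (simp add: algebra_simps)
  then have "(l - (n - 2)) * x z = 0" using ne ev[OF z(1)] by simp
  then show "l = n - 2" using z(2) by simp
qed

text \<open>The constant function 1 is an eigenvector for 2n - 2, the larger of the two
  candidates.\<close>

lemma complete_radius: "radius = 2 * n - 2"
proof (rule antisym)
  have "real (out_degree G u) * 1 + (\<Sum>v\<in>neighbours G u. 1) = (2 * n - 2) * 1"
    if "u \<in> verts G" for u
    using complete_row[OF that, of "\<lambda>_. 1"] by simp
  moreover have "\<exists>u\<in>verts G. (1 :: real) \<noteq> 0" using two_verts by (cases "verts G = {}") auto
  ultimately have "2 * n - 2 \<in># spec"
    unfolding spec_iff by (intro exI[of _ "\<lambda>_. 1"]) blast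
  then show "2 * n - 2 \<le> radius" by (rule spec_le_radius)
  show "radius \<le> 2 * n - 2" using complete_spec[OF radius_in_spec] two_verts by auto
qed

lemma complete_avg: "avg = n - 1"
proof -
  have "n \<noteq> 0" using two_verts by linarith
  then show ?thesis unfolding complete_num_edges by (rule nonzero_mult_div_cancel_left)
qed

text \<open>On the two eigenvalues of a complete graph the absolute deviation agrees with an affine
  function, so the trace gives the energy without computing multiplicities.\<close>
lemma complete_energy: "signless_energy G vs = 2 * n - 2"
proof -
  have n: "n \<ge> 2" using two_verts by simp
  have "\<bar>l - avg\<bar> = (1 - (n - 2) * (n - 2) / n) + (n - 2) / n * l" if "l \<in># spec" for l
    unfolding complete_avg using abs_deviation_affine[OF n complete_spec[OF that]] .
  then have "signless_energy G vs = (\<Sum>l\<in>#spec. (1 - (n - 2) * (n - 2) / n) + (n - 2) / n * l)"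
    unfolding signless_energy_def by (intro arg_cong[of _ _ sum_mset] image_mset_cong)
  also have "\<dots> = 2 * n - 2"
  proof -
    have "(1 - (k - 2) * (k - 2) / k) * k + (k - 2) / k * (k * (k - 1)) = 2 * k - 2"
      if "k \<ge> 2" for k :: real
      using that by (simp add: field_simps)
    then show ?thesis
      unfolding sum_mset_affine sum_spec size_spec complete_num_edges using n by blast
  qed
  finally show ?thesis .
qed

text \<open>Here \<open>deviation_bound\<close> is n (n - 1) and \<open>radius - avg\<close> is n -
  1, so the radicand is the square of n - 1 and both summands equal n - 1.\<close>

lemma complete_energy_eq: "signless_energy G vs =
    (weight_bound - avg) + sqrt ((real (card (verts G)) - 1) * (deviation_bound - (radius - avg)\<^sup>2))"
proof -
  have n: "n \<ge> 2" using two_verts by simp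
  have m: "real (num_edges G) = n * (n - 1) / 2" using complete_num_edges by simp
  have wb: "weight_bound = 2 * n - 2"
    unfolding weight_bound_def complete_num_edges using n by (simp add: field_simps)
  have "(n - 1) * (deviation_bound - (radius - avg)\<^sup>2) = (n - 1)\<^sup>2"
    unfolding deviation_bound_def wb complete_radius complete_avg unfolding m
    by (simp add: power2_eq_square field_simps)
  then have "sqrt ((n - 1) * (deviation_bound - (radius - avg)\<^sup>2)) = n - 1" using n by simp
  then show ?thesis unfolding complete_energy wb complete_avg by simp
qed

end

end

theorem theorem8:
  fixes G :: "('a, 'b) pre_digraph" and vs :: "'a list" and n m :: nat and q B :: real
  assumes "graph G" and "connected G"
    and "distinct vs" and "set vs = verts G"
    and "n = card (verts G)" and "n \<ge> 2"
    and "m = num_edges G"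
    and "q = signless_radius G vs"
    and "B = 2 * real m / (real n * (real n - 1)) + real n - 2
           + sqrt ((real n - 1) *
               (real m * real n
                + 2 * (real m)\<^sup>2 * (2 - real n) / (real n * (real n - 1))
                - (q - 2 * real m / real n)\<^sup>2))"
  shows "signless_energy G vs \<le> B
       \<and> (signless_energy G vs = B \<longleftrightarrow> digraph_iso G (complete_graph n))"
proof -
  interpret graph G by fact
  interpret enumerated_graph G vs
    using assms by unfold_locales auto
  have n: "real n > 1" using \<open>n \<ge> 2\<close> by simp
  \<comment> \<open>The term outside the root is the row sum bound minus the average: 2m/(n-1) -
    2m/n = 2m/(n(n-1)).\<close>
  have 1: "weight_bound - avg = 2 * real m / (real n * (real n - 1)) + real n - 2"
    unfolding weight_bound_def assms(5,7)[symmetric] using n by (simp add: field_simps)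
  have 2: "deviation_bound = real m * real n + 2 * (real m)\<^sup>2 * (2 - real n) / (real n * (real n - 1))"
    unfolding deviation_bound_def weight_bound_def assms(5,7)[symmetric]
    using n by (simp add: field_simps power2_eq_square)
  have B: "B = (weight_bound - avg) + sqrt ((real (card (verts G)) - 1) * (deviation_bound - (radius - avg)\<^sup>2))"
    unfolding 1 2 unfolding assms(9,5,7,8) ..
  have "signless_energy G vs = B \<longleftrightarrow> (\<forall>u\<in>verts G. neighbours G u = verts G - {u})"
    using complete_if_energy_eq complete_energy_eq unfolding B by blast
  then show ?thesis
    using energy_le unfolding B assms(5) digraph_iso_complete_graph_iff by blast
qed

end
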